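(* Suppose $X=\{x_i\}_{i=1}^N\subset\mathbb{CH}^n=\mathbb{B}^n$, $n\ge 2$, is a finite set and $H=DA_n(X)$. (1) If $A_{ijk}=0$ for every $i,j,k$, then $X$ is inside a totally real subspace of $\mathbb{CH}^n$. (2) If $A_{ijk}=0$ for every $i,j,k$ and, furthermore, for every (distinct) $i,j,k,l$ we have $\det MQ_1(\{x_i,x_j,x_k,x_l\})=0$, then $X$ is contained in a real geodesic disk.
   Context: $\mathbb{B}^n\subset\mathbb{C}^n$ is the open unit ball, the model of complex hyperbolic space $\mathbb{CH}^n$; $\operatorname{Aut}(\mathbb{B}^n)$ is its group of biholomorphic automorphisms. A totally real subspace of $\mathbb{CH}^n$ (of dimension $k$) is a totally geodesic submanifold that is the image under an element of $\operatorname{Aut}(\mathbb{B}^n)$ of $\mathbb{B}^n\cap V$, where $V$ is a $k$-dimensional real vector subspace of $\mathbb{C}^n$ spanned by vectors $v_1,\dots,v_k$ with all $\langle v_i,v_j\rangle$ real (it is isometric to real hyperbolic space $\mathbb{RH}^k$). A real geodesic disk is a totally real subspace of dimension two, i.e. an image under $\operatorname{Aut}(\mathbb{B}^n)$ of $\{(x,y,0,\dots,0):x,y\in\mathbb{R},\ x^2+y^2<1\}$. $DA_n$ is the Hilbert space of holomorphic functions on $\mathbb{B}^n$ with kernels $k_z(w)=(1-\langle w,z\rangle)^{-1}$, and $DA_n(X)$ is the span of $\{k_x\}_{x\in X}$. Put $k_{ij}=\langle k_{x_i},k_{x_j}\rangle=(1-\langle x_j,x_i\rangle)^{-1}$ and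 $A_{ijk}=\arg(k_{ij}k_{jk}k_{ki})$ with $|\arg|\le\pi$. For an ordered set $Z=\{z_1,\dots,z_m\}\subset\mathbb{B}^n$ with $\kappa_{ab}=(1-\langle z_b,z_a\rangle)^{-1}$, $MQ_1(Z)$ is the $(m-1)\times(m-1)$ matrix $\left(1-\frac{\kappa_{a1}\kappa_{1b}}{\kappa_{ab}\kappa_{11}}\right)_{2\le a,b\le m}$ (subscript $1$ refers to the first listed point). *)

theory Defs
  imports "HOL-Analysis.Analysis"
begin

definition hermitian :: "complex ^ 'n \<Rightarrow> complex ^ 'n \<Rightarrow> complex"
  where "hermitian z w = (\<Sum>i\<in>UNIV. z $ i * cnj (w $ i))"

abbreviation unit_ball :: "(complex ^ 'n) set"
  where "unit_ball \<equiv> ball 0 1"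

text \<open>
  Holomorphy in several variables: Frechet differentiability with a complex-linear derivative.
  The set is meant to be open, so the full neighbourhood filter is used.
\<close>

definition holomorphic_map_on ::
    "(complex ^ 'n \<Rightarrow> complex ^ 'm) \<Rightarrow> (complex ^ 'n) set \<Rightarrow> bool"
  where "holomorphic_map_on f U \<longleftrightarrow>
    (\<forall>z\<in>U. \<exists>f'. (f has_derivative f') (at z) \<and> (\<forall>c v. f' (c *s v) = c *s f' v))"

text \<open>Automorphisms are total functions; their values outside the ball are irrelevant.\<close>

definition ball_Aut :: "(complex ^ 'n \<Rightarrow> complex ^ 'n) set"
  where "ball_Aut = {\<phi>. bij_betw \<phi> unit_ball unit_ball \<and>
    holomorphic_map_on \<phi> unit_ball \<and>
    holomorphic_map_on (inv_into unit_ball \<phi>) unit_ball}"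

text \<open>
  Here \<^const>\<open>subspace\<close>, \<^const>\<open>span\<close> and \<^const>\<open>dim\<close> are those of the real vector space
  underlying complex n-space.
\<close>

definition totally_real_vector_subspace :: "nat \<Rightarrow> (complex ^ 'n) set \<Rightarrow> bool"
  where "totally_real_vector_subspace k V \<longleftrightarrow> subspace V \<and> dim V = k \<and>
    (\<exists>v :: nat \<Rightarrow> complex ^ 'n. V = span (v ` {1..k}) \<and>
      (\<forall>i\<in>{1..k}. \<forall>j\<in>{1..k}. hermitian (v i) (v j) \<in> \<real>))"

definition totally_real_subspace_of_dim :: "nat \<Rightarrow> (complex ^ 'n) set \<Rightarrow> bool"
  where "totally_real_subspace_of_dim k S \<longleftrightarrow>
    (\<exists>\<phi>\<in>ball_Aut. \<exists>V. totally_real_vector_subspace k V \<and> S = \<phi> ` (unit_ball \<inter> V))"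

definition totally_real_subspace :: "(complex ^ 'n) set \<Rightarrow> bool"
  where "totally_real_subspace S \<longleftrightarrow> (\<exists>k\<ge>1. totally_real_subspace_of_dim k S)"

definition real_geodesic_disk :: "(complex ^ 'n) set \<Rightarrow> bool"
  where "real_geodesic_disk S \<longleftrightarrow> totally_real_subspace_of_dim 2 S"

text \<open>
  The reproducing kernel of the Drury--Arveson space. The function \<open>DA_kernel z\<close> is the kernel
  function at z, so by the reproducing property \<open>DA_kernel z w\<close> is also the inner product of
  the kernel functions at z and at w.
\<close>

definition DA_kernel :: "complex ^ 'n \<Rightarrow> complex ^ 'n \<Rightarrow> complex"
  where "DA_kernel z w = inverse (1 - hermitian w z)"

definition angular_invariant :: "complex ^ 'n \<Rightarrow> complex ^ 'n \<Rightarrow> complex ^ 'n \<Rightarrow> real"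
  where "angular_invariant x y z = Arg (DA_kernel x y * DA_kernel y z * DA_kernel z x)"

text \<open>
  For an ordered set of m points, \<open>p\<close> is the first point and \<open>z\<close> lists the remaining
  m - 1 points, which index the rows and columns.
\<close>

definition MQ1 :: "complex ^ 'n \<Rightarrow> (complex ^ 'n) ^ 'm \<Rightarrow> complex ^ 'm ^ 'm"
  where "MQ1 p z = (\<chi> a b. 1 - (DA_kernel (z $ a) p * DA_kernel p (z $ b)) /
                             (DA_kernel (z $ a) (z $ b) * DA_kernel p p))"

end

theory Submission
  imports Defs
begin

text \<open>
  The involution of the ball exchanging the first point with 0 sends the \<open>x\<^sub>i\<close> to points
  \<open>y\<^sub>i\<close> such that \<open>1 - \<langle>y\<^sub>i, y\<^sub>j\<rangle>\<close> is, up to complex conjugation and a positive factor, the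
  inverse of the triple product of kernels at \<open>x\<^sub>1\<close>, \<open>x\<^sub>i\<close>, \<open>x\<^sub>j\<close>. So vanishing angular invariants make all
  \<open>\<langle>y\<^sub>i, y\<^sub>j\<rangle>\<close> real, and a basis of the real span of the \<open>y\<^sub>i\<close> chosen among them spans a
  totally real subspace. The matrix \<open>MQ\<^sub>1\<close> with base point \<open>x\<^sub>1\<close> is the Gram matrix of
  three of the \<open>y\<^sub>i\<close>, so if it is always singular no three of them are independent.
\<close>

subsection \<open>The Hermitian form\<close>

lemma hermitian_add_left: "hermitian (u + v) w = hermitian u w + hermitian v w"
  by (simp add: hermitian_def distrib_right sum.distrib)

lemma hermitian_diff_left: "hermitian (u - v) w = hermitian u w - hermitian v w"
  by (simp add: hermitian_def left_diff_distrib sum_subtractf)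

lemma hermitian_diff_right: "hermitian u (v - w) = hermitian u v - hermitian u w"
  by (simp add: hermitian_def right_diff_distrib sum_subtractf)

lemma hermitian_smult_left: "hermitian (c *s v) w = c * hermitian v w"
  by (simp add: hermitian_def sum_distrib_left mult.assoc)

lemma hermitian_smult_right: "hermitian v (c *s w) = cnj c * hermitian v w"
  by (simp add: hermitian_def sum_distrib_left ac_simps)

lemma cnj_hermitian: "cnj (hermitian v w) = hermitian w v"
  by (simp add: hermitian_def mult.commute)

lemma Re_hermitian: "Re (hermitian v w) = v \<bullet> w"
  by (simp add: hermitian_def inner_vec_def inner_complex_def)

lemma hermitian_self: "hermitian v v = complex_of_real ((norm v)\<^sup>2)"
proof (rule complex_eqI)
  have "cnj (hermitian v v) = hermitian v v"
    by (rule cnj_hermitian)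
  then show "Im (hermitian v v) = Im (complex_of_real ((norm v)\<^sup>2))"
    by (simp add: complex_eq_iff)
qed (simp add: Re_hermitian power2_norm_eq_inner)

lemma hermitian_Cauchy_Schwarz: "cmod (hermitian v w) \<le> norm v * norm w"
proof -
  have "cmod (hermitian v w) \<le> (\<Sum>i\<in>UNIV. cmod (v $ i) * cmod (w $ i))"
    unfolding hermitian_def by (rule sum_norm_le) (simp add: norm_mult)
  also have "\<dots> \<le> norm v * norm w"
    using L2_set_mult_ineq[of "\<lambda>i. cmod (v $ i)" "\<lambda>i. cmod (w $ i)" UNIV]
    by (simp add: norm_vec_def)
  finally show ?thesis .
qed

text \<open>Keeps the kernels and the denominators of the involution finite on the ball;
  Cauchy-Schwarz puts the product strictly inside the unit disk.\<close>

lemma one_minus_hermitian_neq_0: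
  assumes "v \<in> unit_ball" "w \<in> unit_ball"
  shows "1 - hermitian v w \<noteq> 0"
proof -
  have "norm v * norm w \<le> norm v"
    using mult_left_mono[of "norm w" 1 "norm v"] assms by simp
  then have "cmod (hermitian v w) < 1"
    using hermitian_Cauchy_Schwarz[of v w] assms by simp
  then show ?thesis by auto
qed

lemma bounded_linear_hermitian_left: "bounded_linear (\<lambda>v. hermitian v w)"
proof (rule bounded_linear_intro[where K = "norm w"])
  show "hermitian (r *\<^sub>R v) w = r *\<^sub>R hermitian v w" for r v
    by (simp add: hermitian_def scaleR_sum_right)
qed (simp_all add: hermitian_add_left hermitian_Cauchy_Schwarz)

lemma norm_smult_vec: "norm (c *s v) = cmod c * norm v" for v :: "complex ^ 'n"
  by (simp add: norm_vec_def norm_mult L2_set_right_distrib)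

lemma bounded_bilinear_smult_vec: "bounded_bilinear (\<lambda>c (v :: complex ^ 'n). c *s v)"
proof
  show "\<exists>K. \<forall>c (v :: complex ^ 'n). norm (c *s v) \<le> norm c * norm v * K"
    by (rule exI[of _ 1]) (simp add: norm_smult_vec)
qed (simp_all add: vec_eq_iff algebra_simps)


subsection \<open>The involution exchanging 0 and a point of the ball\<close>

definition ball_radical :: "complex ^ 'n \<Rightarrow> real"
  where "ball_radical a = sqrt (1 - (norm a)\<^sup>2)"

text \<open>
  With s the radical of a, the usual formula
  \<open>(a - P z - s Q z) / (1 - \<langle>z, a\<rangle>)\<close>, where P and Q project onto the complex line of a and onto its
  complement, is rewritten by means of \<open>(1 - s) / |a|\<^sup>2 = 1 / (1 + s)\<close>, so that no case distinction
  on \<open>a = 0\<close> is needed.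
\<close>

definition ball_involution :: "complex ^ 'n \<Rightarrow> complex ^ 'n \<Rightarrow> complex ^ 'n"
  where "ball_involution a z = inverse (1 - hermitian z a) *s
    ((1 - hermitian z a / (1 + of_real (ball_radical a))) *s a - of_real (ball_radical a) *s z)"

context
  fixes a :: "complex ^ 'n"
  assumes a: "a \<in> unit_ball"
begin

lemma ball_radical_pos: "ball_radical a > 0"
  using a by (simp add: ball_radical_def power_less_one_iff abs_square_less_1)

lemma hermitian_self_radical: "hermitian a a = 1 - (complex_of_real (ball_radical a))\<^sup>2"
proof -
  have "(ball_radical a)\<^sup>2 = 1 - (norm a)\<^sup>2"
    using a by (simp add: ball_radical_def abs_square_le_1)
  then show ?thesis
    by (simp add: hermitian_self flip: of_real_power)
qed

lemma radical_nz: "complex_of_real (ball_radical a) \<noteq> 0" "1 + complex_of_real (ball_radical a) \<noteq> 0"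
  using ball_radical_pos by (simp_all add: complex_eq_iff)

lemma ball_involution_self: "ball_involution a a = 0"
proof -
  have "1 - hermitian a a / (1 + of_real (ball_radical a)) = of_real (ball_radical a)"
    using radical_nz by (simp add: hermitian_self_radical field_simps power2_eq_square)
  then show ?thesis by (simp add: ball_involution_def)
qed

text \<open>The transformation law of the kernel. Invariance of the ball, reality of the Gram
  entries and the meaning of \<open>MQ1\<close> are all read off from it.\<close>

lemma one_minus_hermitian_ball_involution:
  assumes z: "z \<in> unit_ball" and w: "w \<in> unit_ball"
  shows "1 - hermitian (ball_involution a z) (ball_involution a w) =
    (1 - hermitian a a) * (1 - hermitian z w) / ((1 - hermitian z a) * (1 - hermitian a w))"
proof -
  define s where "s = complex_of_real (ball_radical a)"
  define t where "t = hermitian z a"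
  define u where "u = hermitian a w"
  define h where "h = hermitian z w"
  have s: "s \<noteq> 0" "1 + s \<noteq> 0" "cnj s = s"
    using radical_nz by (simp_all add: s_def)
  have nz: "1 - t \<noteq> 0" "1 - u \<noteq> 0"
    using a z w one_minus_hermitian_neq_0 by (auto simp: t_def u_def)
  have cu: "cnj (hermitian w a) = u"
    by (simp add: u_def cnj_hermitian)
  have aa: "hermitian a a = 1 - s\<^sup>2"
    by (simp add: hermitian_self_radical s_def)
  \<comment> \<open>\<open>c\<close> and \<open>d\<close> are the coefficients of \<open>a\<close>
    in the numerators of the images of \<open>z\<close> and \<open>w\<close>.\<close>
  define c where "c = 1 - t / (1 + s)"
  define d where "d = 1 - cnj u / (1 + s)"
  have cd: "cnj d = 1 - u / (1 + s)"
    by (simp add: d_def s)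
  have "hermitian (c *s a - s *s z) (d *s a - s *s w) =
      c * cnj d * (1 - s\<^sup>2) - c * s * u - s * cnj d * t + s\<^sup>2 * h"
    unfolding hermitian_diff_left hermitian_diff_right hermitian_smult_left hermitian_smult_right
      aa t_def[symmetric] u_def[symmetric] h_def[symmetric] s(3)
    by (simp add: algebra_simps power2_eq_square)
  moreover have "ball_involution a z = inverse (1 - t) *s (c *s a - s *s z)"
    by (simp only: ball_involution_def s_def t_def c_def)
  moreover have "ball_involution a w = inverse (1 - cnj u) *s (d *s a - s *s w)"
    by (simp only: ball_involution_def s_def u_def d_def cnj_hermitian)
  ultimately have "hermitian (ball_involution a z) (ball_involution a w) =
      (c * cnj d * (1 - s\<^sup>2) - c * s * u - s * cnj d * t + s\<^sup>2 * h) / ((1 - t) * (1 - u))"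
    by (simp only: hermitian_smult_left hermitian_smult_right) (simp add: field_simps)
  moreover have "c * cnj d * (1 - s\<^sup>2) - c * s * u - s * cnj d * t + s\<^sup>2 * h =
      (1 - t) * (1 - u) - s\<^sup>2 * (1 - h)"
  proof -
    \<comment> \<open>Eliminating \<open>t\<close> and \<open>u\<close> instead of \<open>c\<close>
      and \<open>d\<close> removes the divisions by \<open>1 + s\<close> and leaves a polynomial
      identity.\<close>
    have tu: "t = (1 - c) * (1 + s)" "u = (1 - cnj d) * (1 + s)"
      using s by (simp_all add: c_def cd)
    show ?thesis
      unfolding tu by (simp add: algebra_simps power2_eq_square)
  qed
  ultimately show ?thesis
    using nz by (simp add: aa diff_divide_distrib flip: t_def u_def h_def)
qed

lemma ball_involution_in_ball:
  assumes z: "z \<in> unit_ball"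
  shows "ball_involution a z \<in> unit_ball"
proof -
  \<comment> \<open>For \<open>w = z\<close> the two denominators of the transformation law are
    conjugate, so the law becomes an equation of reals with positive right-hand side.\<close>
  have "(1 - hermitian z a) * (1 - hermitian a z) = complex_of_real ((cmod (1 - hermitian z a))\<^sup>2)"
    by (simp add: complex_norm_square cnj_hermitian del: of_real_power)
  then have "complex_of_real (1 - (norm (ball_involution a z))\<^sup>2) =
    complex_of_real ((1 - (norm a)\<^sup>2) * (1 - (norm z)\<^sup>2) / (cmod (1 - hermitian z a))\<^sup>2)"
    using one_minus_hermitian_ball_involution[OF z z] by (simp add: hermitian_self)
  then have "1 - (norm (ball_involution a z))\<^sup>2 =
    (1 - (norm a)\<^sup>2) * (1 - (norm z)\<^sup>2) / (cmod (1 - hermitian z a))\<^sup>2"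
    by (simp only: of_real_eq_iff)
  also have "\<dots> > 0"
    using a z one_minus_hermitian_neq_0[OF z a]
    by (intro divide_pos_pos mult_pos_pos) (simp_all add: abs_square_less_1)
  finally show ?thesis
    by (simp add: abs_square_less_1)
qed

text \<open>The denominator of the second application is \<open>s\<^sup>2 / (1 - t)\<close>, which
  cancels that of the first. In each coordinate the coefficient of \<open>a\<close> then vanishes
  and that of \<open>z\<close> is 1.\<close>

lemma ball_involution_involution:
  assumes z: "z \<in> unit_ball"
  shows "ball_involution a (ball_involution a z) = z"
proof -
  define s where "s = complex_of_real (ball_radical a)"
  define t where "t = hermitian z a"
  define p where "p = ball_involution a z"
  have s: "s \<noteq> 0" "1 + s \<noteq> 0"
    using radical_nz by (simp_all add: s_def)
  have nz: "1 - t \<noteq> 0"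
    using a z one_minus_hermitian_neq_0 by (auto simp: t_def)
  have aa: "hermitian a a = 1 - s\<^sup>2"
    by (simp add: hermitian_self_radical s_def)
  have p: "p = inverse (1 - t) *s ((1 - t / (1 + s)) *s a - s *s z)"
    by (simp add: p_def ball_involution_def s_def t_def)
  have pa: "hermitian p a = (1 - s\<^sup>2 - t) / (1 - t)"
  proof -
    have "hermitian p a = inverse (1 - t) * ((1 - t / (1 + s)) * (1 - s\<^sup>2) - s * t)"
      by (simp only: p hermitian_smult_left hermitian_diff_left aa t_def)
    also have "(1 - t / (1 + s)) * (1 - s\<^sup>2) - s * t = 1 - s\<^sup>2 - t"
      using s by (simp add: field_simps power2_eq_square)
    finally show ?thesis by (simp add: divide_inverse mult.commute)
  qed
  have inv: "inverse (1 - hermitian p a) = (1 - t) / s\<^sup>2"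
    using nz s by (simp add: pa field_simps)
  have "ball_involution a p $ i = z $ i" for i
  proof -
    have p_i: "p $ i = inverse (1 - t) * ((1 - t / (1 + s)) * a $ i - s * z $ i)"
      by (simp only: p vector_smult_component vector_minus_component)
    have "ball_involution a p $ i = (1 - t) / s\<^sup>2 *
       ((1 - (1 - s\<^sup>2 - t) / (1 - t) / (1 + s)) * a $ i
         - s * (inverse (1 - t) * ((1 - t / (1 + s)) * a $ i - s * z $ i)))"
      unfolding ball_involution_def[of a p] s_def[symmetric] inv
      by (simp only: pa vector_smult_component vector_minus_component p_i)
    also have "\<dots> = 1 / s\<^sup>2 *
       (((1 - t) - (1 - s\<^sup>2 - t) / (1 + s)) * a $ i - s * ((1 - t / (1 + s)) * a $ i - s * z $ i))"
      using nz s by (simp add: divide_simps)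
    also have "(1 - t) - (1 - s\<^sup>2 - t) / (1 + s) = s * (1 - t / (1 + s))"
      using s by (simp add: field_simps power2_eq_square)
    also have "1 / s\<^sup>2 * (s * (1 - t / (1 + s)) * a $ i - s * ((1 - t / (1 + s)) * a $ i - s * z $ i))
        = z $ i"
      using s by (simp add: algebra_simps power2_eq_square)
    finally show ?thesis .
  qed
  then show ?thesis by (simp add: vec_eq_iff p_def)
qed

lemma holomorphic_ball_involution: "holomorphic_map_on (ball_involution a) unit_ball"
  unfolding holomorphic_map_on_def
proof
  fix z :: "complex ^ 'n" assume z: "z \<in> unit_ball"
  define s where "s = complex_of_real (ball_radical a)"
  let ?g = "\<lambda>z. inverse (1 - hermitian z a)"
  let ?L = "\<lambda>z. (1 - hermitian z a / (1 + s)) *s a - s *s z"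
  \<comment> \<open>The form is complex-linear in its first argument, hence so are
    \<open>?g'\<close> and \<open>?L'\<close>, and with them the derivative from the product
    rule.\<close>
  let ?g' = "\<lambda>v. hermitian v a * (?g z)\<^sup>2"
  let ?L' = "\<lambda>v. (- (hermitian v a / (1 + s))) *s a - s *s v"
  note [derivative_intros] = bounded_linear.has_derivative[OF bounded_linear_hermitian_left]
    bounded_bilinear.FDERIV[OF bounded_bilinear_smult_vec]
  have g: "(?g has_derivative ?g') (at z)"
    using one_minus_hermitian_neq_0[OF z a]
    by (auto intro!: derivative_eq_intros simp: power2_eq_square)
  have L: "(?L has_derivative ?L') (at z)"
    using radical_nz by (auto intro!: derivative_eq_intros simp: s_def)
  let ?f' = "\<lambda>v. ?g z *s ?L' v + ?g' v *s ?L z"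
  have "((\<lambda>z. ?g z *s ?L z) has_derivative ?f') (at z)"
    by (rule bounded_bilinear.FDERIV[OF bounded_bilinear_smult_vec g L])
  moreover have "(\<lambda>z. ?g z *s ?L z) = ball_involution a"
    by (simp add: ball_involution_def s_def fun_eq_iff)
  ultimately have "(ball_involution a has_derivative ?f') (at z)"
    by (simp only:)
  moreover have "?f' (c *s v) = c *s ?f' v" for c v
    by (simp add: hermitian_smult_left vec_eq_iff algebra_simps)
  ultimately show "\<exists>f'. (ball_involution a has_derivative f') (at z) \<and> (\<forall>c v. f' (c *s v) = c *s f' v)"
    by (intro exI[of _ ?f'] conjI allI)
qed

lemma ball_involution_Aut: "ball_involution a \<in> ball_Aut"
proof -
  have bij: "bij_betw (ball_involution a) unit_ball unit_ball"
    by (rule bij_betw_byWitness[where f' = "ball_involution a"])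
      (auto simp: ball_involution_involution simp del: mem_ball_0 intro: ball_involution_in_ball)
  have inv: "inv_into unit_ball (ball_involution a) z = ball_involution a z" if "z \<in> unit_ball" for z
    using that bij ball_involution_in_ball ball_involution_involution
    by (metis bij_betw_def inv_into_f_f)
  \<comment> \<open>The inverse agrees with the involution only on the ball; as the ball is open,
    this suffices to transfer derivatives.\<close>
  have deriv: "(inv_into unit_ball (ball_involution a) has_derivative f') (at z)"
    if "(ball_involution a has_derivative f') (at z)" "z \<in> unit_ball" for f' z
    by (rule has_derivative_transform_within_open[OF that(1) open_ball that(2)]) (rule inv[symmetric])
  have "holomorphic_map_on (inv_into unit_ball (ball_involution a)) unit_ball"
    using holomorphic_ball_involution deriv unfolding holomorphic_map_on_def by fast
  with bij holomorphic_ball_involution show ?thesis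
    by (simp add: ball_Aut_def)
qed

section \<open>Angular invariants and \<open>MQ1\<close> seen through the involution\<close>

lemma hermitian_ball_involution_real:
  assumes z: "z \<in> unit_ball" and w: "w \<in> unit_ball" and ang: "angular_invariant a z w = 0"
  shows "hermitian (ball_involution a z) (ball_involution a w) \<in> \<real>"
proof -
  define P where "P = 1 - hermitian z a"
  define Q where "Q = 1 - hermitian w z"
  define R where "R = 1 - hermitian a w"
  have nz: "P \<noteq> 0" "R \<noteq> 0"
    using a z w one_minus_hermitian_neq_0 by (auto simp: P_def R_def)
  have cnjs: "cnj P = 1 - hermitian a z" "cnj Q = 1 - hermitian z w" "cnj R = 1 - hermitian w a"
    by (simp_all add: P_def Q_def R_def cnj_hermitian)
  have k: "DA_kernel a z * DA_kernel z w * DA_kernel w a = inverse (P * Q * R)"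
    by (simp add: DA_kernel_def P_def Q_def R_def)
  have "inverse (P * Q * R) \<in> \<real>"
    using ang unfolding angular_invariant_def Arg_eq_0 k by simp
  \<comment> \<open>This positive factor turns \<open>P * Q * R\<close> into the conjugate of the
    right-hand side of the transformation law.\<close>
  then have "inverse (inverse (P * Q * R)) *
      complex_of_real ((1 - (norm a)\<^sup>2) / ((cmod P)\<^sup>2 * (cmod R)\<^sup>2)) \<in> \<real>"
    by (rule Reals_mult[OF Reals_inverse Reals_of_real])
  also have "inverse (inverse (P * Q * R)) *
      complex_of_real ((1 - (norm a)\<^sup>2) / ((cmod P)\<^sup>2 * (cmod R)\<^sup>2)) =
      (1 - hermitian a a) * (P * Q * R) / ((P * cnj P) * (R * cnj R))"
    by (simp only: hermitian_self inverse_inverse_eq of_real_divide of_real_mult of_real_diff of_real_1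
        complex_norm_square) (simp add: ac_simps)
  also have "\<dots> = (1 - hermitian a a) * Q / (cnj P * cnj R)"
    using nz by (simp add: divide_simps)
  also have "\<dots> = cnj ((1 - hermitian a a) * cnj Q / (P * R))"
    by (simp add: cnj_hermitian)
  also have "(1 - hermitian a a) * cnj Q / (P * R) =
      1 - hermitian (ball_involution a z) (ball_involution a w)"
    unfolding one_minus_hermitian_ball_involution[OF z w] cnjs by (simp only: P_def R_def)
  finally have "cnj (1 - hermitian (ball_involution a z) (ball_involution a w)) \<in> \<real>" .
  then show ?thesis by (simp add: complex_is_Real_iff)
qed

text \<open>The quotient of kernels in \<open>MQ1\<close> is the right-hand side of the
  transformation law. The order \<open>j\<close>, \<open>i\<close> arises because
  \<open>DA_kernel z w\<close> contains \<open>hermitian w z\<close>.\<close>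

lemma MQ1_eq_Gram:
  fixes z :: "(complex ^ 'n) ^ 'm"
  assumes "\<And>i. z $ i \<in> unit_ball"
  shows "MQ1 a z $ i $ j = hermitian (ball_involution a (z $ j)) (ball_involution a (z $ i))"
proof -
  have "1 - MQ1 a z $ i $ j =
      1 - hermitian (ball_involution a (z $ j)) (ball_involution a (z $ i))"
    unfolding one_minus_hermitian_ball_involution[OF assms assms]
    by (simp add: MQ1_def DA_kernel_def divide_inverse ac_simps)
  then show ?thesis by simp
qed

end


subsection \<open>Totally real sets of vectors\<close>

lemma totally_real_vector_subspace_span:
  assumes "finite B" "independent B" "\<forall>u\<in>B. \<forall>v\<in>B. hermitian u v \<in> \<real>"
  shows "totally_real_vector_subspace (card B) (span B)"
proof -
  obtain v where v: "bij_betw v {1..card B} B"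
    using ex_bij_betw_nat_finite_1[OF assms(1)] by blast
  then have "v ` {1..card B} = B" by (simp add: bij_betw_def)
  with assms show ?thesis
    unfolding totally_real_vector_subspace_def
    by (intro conjI exI[of _ v]) (auto simp: dim_eq_card_independent)
qed

lemma exists_hermitian_orthogonal:
  fixes v :: "complex ^ 'n"
  assumes "CARD('n) \<ge> 2"
  obtains w where "w \<noteq> 0" "hermitian v w = 0"
proof -
  obtain i j :: 'n where ij: "i \<noteq> j"
    using assms by (metis card_2_iff' ex_card)
  have ax: "hermitian v (axis k 1) = v $ k" for k
    by (simp add: hermitian_def axis_def if_distrib[of cnj] if_distrib[of "(*) _"] cong: if_cong)
  show thesis
  proof (cases "v $ i = 0")
    case True
    show thesis
      by (rule that[of "axis i 1"]) (simp_all add: ax True)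
  next
    case False
    \<comment> \<open>The coefficients are conjugated because the form is conjugate-linear in its
      second argument; the two products then cancel.\<close>
    let ?w = "cnj (v $ j) *s axis i 1 - cnj (v $ i) *s axis j 1 :: complex ^ 'n"
    have "?w $ j \<noteq> 0" using False ij by (simp add: axis_def)
    then have "?w \<noteq> 0" by (metis zero_index)
    moreover have "hermitian v ?w = 0"
      by (simp add: hermitian_diff_right hermitian_smult_right ax)
    ultimately show thesis by (rule that)
  qed
qed

text \<open>Covers the case in which every image is 0 and the basis is empty, since
  \<open>totally_real_subspace\<close> asks for dimension at least 1.\<close>

lemma extend_totally_real_to_nonempty:
  fixes B :: "(complex ^ 'n) set"
  assumes "finite B" "independent B" "\<forall>u\<in>B. \<forall>v\<in>B. hermitian u v \<in> \<real>"
  obtains C where "finite C" "independent C" "C \<noteq> {}" "B \<subseteq> C" "card C \<le> max 1 (card B)"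
    "\<forall>u\<in>C. \<forall>v\<in>C. hermitian u v \<in> \<real>"
proof (cases "B = {}")
  case True
  define e :: "complex ^ 'n" where "e = axis undefined 1"
  have "e \<noteq> 0" by (simp add: e_def)
  with True show thesis
    by (intro that[of "{e}"]) (auto simp: hermitian_self)
next
  case False
  show thesis
    by (rule that[of B]) (use assms False in simp_all)
qed

text \<open>A real geodesic disk has dimension exactly 2, so a smaller basis must be enlarged. A
  Hermitian-orthogonal vector adds only the product 0, and its real orthogonality gives independence
  over the reals.\<close>

lemma extend_totally_real_to_pair:
  fixes B :: "(complex ^ 'n) set"
  assumes n: "CARD('n) \<ge> 2"
    and B: "finite B" "independent B" "\<forall>u\<in>B. \<forall>v\<in>B. hermitian u v \<in> \<real>"
    and "card B \<le> 2"
  obtains C where "finite C" "independent C" "card C = 2" "B \<subseteq> C"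
    "\<forall>u\<in>C. \<forall>v\<in>C. hermitian u v \<in> \<real>"
proof -
  obtain C where C: "finite C" "independent C" "C \<noteq> {}" "B \<subseteq> C" "card C \<le> max 1 (card B)"
    "\<forall>u\<in>C. \<forall>v\<in>C. hermitian u v \<in> \<real>"
    by (rule extend_totally_real_to_nonempty[OF B])
  have "card C \<noteq> 0" "card C \<le> 2" using C \<open>card B \<le> 2\<close> by auto
  then consider "card C = 2" | "card C = 1" by linarith
  then show thesis
  proof cases
    case 1
    with C that show thesis by blast
  next
    case 2
    then obtain v where v: "C = {v}" by (rule card_1_singletonE)
    with C have "v \<noteq> 0" by simp
    obtain w where w: "w \<noteq> 0" "hermitian v w = 0"
      using exists_hermitian_orthogonal[OF n] .
    have wv: "hermitian w v = 0" using w cnj_hermitian[of v w] by simp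
    have orth: "v \<bullet> w = 0" "w \<bullet> v = 0"
      using w wv by (simp_all flip: Re_hermitian)
    have "v \<noteq> w" using \<open>v \<noteq> 0\<close> orth by auto
    show thesis
    proof (rule that[of "{v, w}"])
      show "independent {v, w}"
        by (rule pairwise_orthogonal_independent)
          (use orth \<open>v \<noteq> 0\<close> w in \<open>auto simp: pairwise_def orthogonal_def\<close>)
    qed (use C v w wv \<open>v \<noteq> w\<close> in \<open>auto simp: hermitian_self\<close>)
  qed
qed

text \<open>A singular \<open>M\<close> kills some complex \<open>c \<noteq> 0\<close>. Since
  \<open>M\<close> is real, it also kills the real and imaginary parts of \<open>c\<close>, one of
  which is nonzero and gives a real linear relation.\<close>

lemma totally_real_Gram_det_0_imp_dependent:
  fixes y :: "3 \<Rightarrow> complex ^ 'n" and M :: "complex ^ 3 ^ 3"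
  assumes inj: "inj y"
    and real: "\<And>i j. hermitian (y i) (y j) \<in> \<real>"
    and M: "\<And>i j. M $ i $ j = hermitian (y j) (y i)"
    and det: "det M = 0"
  shows "dependent (range y)"
proof -
  obtain c where c: "c \<noteq> 0" "M *v c = 0"
    using det invertible_det_nz[of M] matrix_left_invertible_ker[of M] invertible_left_inverse[of M]
    by blast
  have inner: "M $ i $ j = complex_of_real (y j \<bullet> y i)" for i j
    using real[of j i] by (simp add: M Re_hermitian[symmetric] )
  have sum0: "(\<Sum>j\<in>UNIV. complex_of_real (y j \<bullet> y i) * c $ j) = 0" for i
    using c(2) by (simp add: matrix_vector_mult_def vec_eq_iff inner)
  \<comment> \<open>The quadratic form of a Gram matrix at \<open>r\<close> is the squared norm of
    the combination with coefficients \<open>r\<close>.\<close>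
  have null: "(\<Sum>j\<in>UNIV. r j *\<^sub>R y j) = 0" if "\<And>i. (\<Sum>j\<in>UNIV. r j * (y j \<bullet> y i)) = 0" for r
  proof -
    have "(\<Sum>j\<in>UNIV. r j *\<^sub>R y j) \<bullet> (\<Sum>i\<in>UNIV. r i *\<^sub>R y i) =
        (\<Sum>i\<in>UNIV. r i * (\<Sum>j\<in>UNIV. r j * (y j \<bullet> y i)))"
      by (simp add: inner_sum_right inner_sum_left)
    also have "\<dots> = 0" by (simp only: that mult_zero_right sum.neutral_const)
    finally show ?thesis by simp
  qed
  \<comment> \<open>Injectivity of \<open>y\<close> turns coefficients on indices into coefficients
    on vectors.\<close>
  have dep: "dependent (range y)" if "(\<Sum>j\<in>UNIV. r j *\<^sub>R y j) = 0" "r i \<noteq> 0" for r i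
  proof -
    have "(\<Sum>v\<in>range y. r (inv y v) *\<^sub>R v) = 0"
      using that(1) by (subst sum.reindex[OF inj]) (simp add: inj)
    moreover have "r (inv y (y i)) \<noteq> 0" using that(2) inj by simp
    ultimately show ?thesis
      by (subst dependent_finite) (auto intro!: exI[of _ "\<lambda>v. r (inv y v)"])
  qed
  obtain i where "c $ i \<noteq> 0" using c(1) by (auto simp: vec_eq_iff)
  then consider "Re (c $ i) \<noteq> 0" | "Im (c $ i) \<noteq> 0" by (auto simp: complex_eq_iff)
  then show ?thesis
  proof cases
    case 1
    have "(\<Sum>j\<in>UNIV. Re (c $ j) * (y j \<bullet> y k)) = 0" for k
      using arg_cong[OF sum0[of k], of Re] by (simp add: mult.commute)
    from dep[OF null[OF this] 1] show ?thesis .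
  next
    case 2
    have "(\<Sum>j\<in>UNIV. Im (c $ j) * (y j \<bullet> y k)) = 0" for k
      using arg_cong[OF sum0[of k], of Im] by (simp add: mult.commute)
    from dep[OF null[OF this] 2] show ?thesis .
  qed
qed

text \<open>The involution is its own inverse, so applying it to the part of \<open>span B\<close>
  inside the ball recovers every point of \<open>X\<close>.\<close>

lemma subset_totally_real_image:
  assumes a: "a \<in> unit_ball" and X: "X \<subseteq> unit_ball"
    and B: "finite B" "independent B" "\<forall>u\<in>B. \<forall>v\<in>B. hermitian u v \<in> \<real>"
    and sub: "ball_involution a ` X \<subseteq> span B"
  shows "\<exists>S. totally_real_subspace_of_dim (card B) S \<and> X \<subseteq> S"
proof (intro exI conjI)
  show "totally_real_subspace_of_dim (card B) (ball_involution a ` (unit_ball \<inter> span B))"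
    unfolding totally_real_subspace_of_dim_def
    using ball_involution_Aut[OF a] totally_real_vector_subspace_span[OF B] by blast
  show "X \<subseteq> ball_involution a ` (unit_ball \<inter> span B)"
  proof
    fix z assume z: "z \<in> X"
    then have "z = ball_involution a (ball_involution a z)"
      using X ball_involution_involution[OF a] by (metis subsetD)
    moreover have "ball_involution a z \<in> unit_ball \<inter> span B"
      using z X sub ball_involution_in_ball[OF a] by blast
    ultimately show "z \<in> ball_involution a ` (unit_ball \<inter> span B)" by (rule image_eqI)
  qed
qed

section \<open>Both claims from a real basis of the images of the points\<close>

theorem proposition32:
  fixes x :: "nat \<Rightarrow> complex ^ 'n" and N :: nat and X :: "(complex ^ 'n) set"
  assumes "CARD('n) \<ge> 2"
    and "X = x ` {1..N}"
    and "X \<subseteq> unit_ball"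
  shows "((\<forall>i\<in>{1..N}. \<forall>j\<in>{1..N}. \<forall>k\<in>{1..N}. angular_invariant (x i) (x j) (x k) = 0)
            \<longrightarrow> (\<exists>S. totally_real_subspace S \<and> X \<subseteq> S))
       \<and> ((\<forall>i\<in>{1..N}. \<forall>j\<in>{1..N}. \<forall>k\<in>{1..N}. angular_invariant (x i) (x j) (x k) = 0) \<and>
          (\<forall>i\<in>{1..N}. \<forall>j\<in>{1..N}. \<forall>k\<in>{1..N}. \<forall>l\<in>{1..N}. distinct [i, j, k, l] \<longrightarrow>
             det (MQ1 (x i) (vector [x j, x k, x l] :: (complex ^ 'n) ^ 3)) = 0)
            \<longrightarrow> (\<exists>D. real_geodesic_disk D \<and> X \<subseteq> D))"
proof -
  \<comment> \<open>For \<open>N = 0\<close> there is no first point; 0 is a default that lies in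
    the ball.\<close>
  define a where "a = (if N = 0 then 0 else x 1)"
  define f where "f = ball_involution a"
  have xb: "x i \<in> unit_ball" if "i \<in> {1..N}" for i
    using that assms by blast
  have a: "a \<in> unit_ball"
    using xb[of 1] by (auto simp: a_def)
  have a1: "a = x 1" "1 \<in> {1..N}" if "i \<in> {1..N}" for i
    using that by (auto simp: a_def)
  \<comment> \<open>Choosing the basis among the images makes its Hermitian products those of images
    of points of \<open>X\<close>, which the angular invariants control.\<close>
  obtain B where B: "B \<subseteq> f ` X" "independent B" "f ` X \<subseteq> span B"
    using maximal_independent_subset[of "f ` X"] by blast
  have fin: "finite B"
    using B(1) assms(2) by (auto intro: finite_subset)
  have real: "\<forall>u\<in>B. \<forall>v\<in>B. hermitian u v \<in> \<real>"
    if ang: "\<forall>i\<in>{1..N}. \<forall>j\<in>{1..N}. \<forall>k\<in>{1..N}. angular_invariant (x i) (x j) (x k) = 0"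
  proof (intro ballI)
    fix u v assume "u \<in> B" "v \<in> B"
    then have "u \<in> f ` x ` {1..N}" "v \<in> f ` x ` {1..N}"
      using B(1) assms(2) by blast+
    then obtain i j where ij: "i \<in> {1..N}" "j \<in> {1..N}" and uv: "u = f (x i)" "v = f (x j)"
      by (elim imageE) metis
    have "angular_invariant a (x i) (x j) = 0"
      using ang ij a1[OF ij(1)] by simp
    then show "hermitian u v \<in> \<real>"
      unfolding uv f_def by (rule hermitian_ball_involution_real[OF a xb[OF ij(1)] xb[OF ij(2)]])
  qed
  show ?thesis
  proof (intro conjI impI)
    assume ang: "\<forall>i\<in>{1..N}. \<forall>j\<in>{1..N}. \<forall>k\<in>{1..N}. angular_invariant (x i) (x j) (x k) = 0"
    obtain C where C: "finite C" "independent C" "C \<noteq> {}" "B \<subseteq> C" "card C \<le> max 1 (card B)"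
      "\<forall>u\<in>C. \<forall>v\<in>C. hermitian u v \<in> \<real>"
      by (rule extend_totally_real_to_nonempty[OF fin B(2) real[OF ang]])
    have "card C \<ge> 1" using C by (simp add: Suc_le_eq card_gt_0_iff)
    moreover have "ball_involution a ` X \<subseteq> span C"
      using B(3) span_mono[OF C(4)] by (auto simp: f_def)
    ultimately show "\<exists>S. totally_real_subspace S \<and> X \<subseteq> S"
      using subset_totally_real_image[OF a assms(3) C(1,2,6)]
      unfolding totally_real_subspace_def by blast
  next
    assume "(\<forall>i\<in>{1..N}. \<forall>j\<in>{1..N}. \<forall>k\<in>{1..N}. angular_invariant (x i) (x j) (x k) = 0) \<and>
          (\<forall>i\<in>{1..N}. \<forall>j\<in>{1..N}. \<forall>k\<in>{1..N}. \<forall>l\<in>{1..N}. distinct [i, j, k, l] \<longrightarrow>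
             det (MQ1 (x i) (vector [x j, x k, x l] :: (complex ^ 'n) ^ 3)) = 0)"
    then have ang: "\<forall>i\<in>{1..N}. \<forall>j\<in>{1..N}. \<forall>k\<in>{1..N}. angular_invariant (x i) (x j) (x k) = 0"
      and det: "\<And>i j k l. i \<in> {1..N} \<Longrightarrow> j \<in> {1..N} \<Longrightarrow> k \<in> {1..N} \<Longrightarrow> l \<in> {1..N} \<Longrightarrow>
        distinct [i, j, k, l] \<Longrightarrow>
        det (MQ1 (x i) (vector [x j, x k, x l] :: (complex ^ 'n) ^ 3)) = 0"
      by blast+
    have "card B \<le> 2"
    proof (rule ccontr)
      assume "\<not> card B \<le> 2"
      then have "3 \<le> card B" by simp
      then obtain T where T: "T \<subseteq> B" "card T = 3"
        by (metis obtain_subset_with_card_n)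
      then obtain p q r where pqr: "T = {p, q, r}" "p \<noteq> q" "q \<noteq> r" "p \<noteq> r"
        by (auto simp: card_3_iff)
      then have "p \<in> f ` x ` {1..N}" "q \<in> f ` x ` {1..N}" "r \<in> f ` x ` {1..N}"
        using T(1) B(1) assms(2) by blast+
      then obtain j k l where jkl: "j \<in> {1..N}" "k \<in> {1..N}" "l \<in> {1..N}"
        and eq: "p = f (x j)" "q = f (x k)" "r = f (x l)"
        by (elim imageE) metis
      define z :: "(complex ^ 'n) ^ 3" where "z = vector [x j, x k, x l]"
      define y where "y = (\<lambda>i. f (z $ i))"
      have z: "z $ 1 = x j" "z $ 2 = x k" "z $ 3 = x l" by (simp_all add: z_def)
      have range_y: "range y = T" by (auto simp: UNIV_3 y_def z pqr eq)
      have "x 1 = a" "f (x 1) = 0"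
        using a1[OF jkl(1)] ball_involution_self[OF a] by (simp_all add: f_def)
      \<comment> \<open>The base point goes to 0, which no independent set contains. So
        \<open>j\<close>, \<open>k\<close>, \<open>l\<close> differ from 1, and the determinant
        hypothesis applies with \<open>x 1\<close> listed first.\<close>
      moreover have "0 \<notin> T"
        using T(1) B(2) dependent_zero by blast
      ultimately have "distinct [1, j, k, l]"
        using pqr by (auto simp: eq)
      from det[OF a1(2)[OF jkl(1)] jkl this] have "det (MQ1 a z) = 0"
        by (simp only: z_def \<open>x 1 = a\<close>)
      moreover have "MQ1 a z $ i $ j = hermitian (y j) (y i)" for i j
        unfolding y_def f_def
        by (rule MQ1_eq_Gram[OF a]) (use exhaust_3 z xb jkl in metis)
      moreover have "inj y"
        using T(2) by (intro eq_card_imp_inj_on) (simp_all add: range_y)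
      moreover have "hermitian (y i) (y j) \<in> \<real>" for i j
        using real[OF ang] range_y T(1) by blast
      ultimately have "dependent T"
        using totally_real_Gram_det_0_imp_dependent[of y "MQ1 a z"] by (simp only: range_y)
      with T(1) B(2) show False
        using dependent_mono by blast
    qed
    obtain C where C: "finite C" "independent C" "card C = 2" "B \<subseteq> C"
      "\<forall>u\<in>C. \<forall>v\<in>C. hermitian u v \<in> \<real>"
      by (rule extend_totally_real_to_pair[OF assms(1) fin B(2) real[OF ang] \<open>card B \<le> 2\<close>])
    have "ball_involution a ` X \<subseteq> span C"
      using B(3) span_mono[OF C(4)] by (auto simp: f_def)
    then show "\<exists>D. real_geodesic_disk D \<and> X \<subseteq> D"
      using subset_totally_real_image[OF a assms(3) C(1,2,5)] C(3)
      by (simp add: real_geodesic_disk_def)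
  qed
qed

end
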